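(* Let $G$ be a finite pseudo reflection group and $\Upsilon=\{\mu_s,\tau_i\}$ admissible parameters. Let $V_G=\bigoplus_{i\in P}\mathbb Cv_i$, $\iota(w)v_i=v_{w(i)}$, and let $p_i\in\mathrm{End}(V_G)$ be defined by $p_i(v_i)=\tau_iv_i$ and $p_i(v_j)=\alpha_{i,j}v_i$ for $j\neq i$, where $\alpha_{i,j}=\sum_{s\in R(i,j)}\mu_s$. Then the assignment $T_w\mapsto\iota(w)$ ($w\in G$), $e_i\mapsto p_i$ ($i\in P$) extends to a representation $B_G(\Upsilon)\to\mathrm{End}(V_G)$.
   Context: $G\subset U(V)$ a finite pseudo reflection group with pseudo reflections $R$, reflecting hyperplanes $\{H_i\}_{i\in P}$, $w(i)$ defined by $H_{w(i)}=w(H_i)$, $R(i,j)=\{s\in R:s(H_j)=H_i\}$, $s_i$ the generator of the pointwise stabilizer $G_i$ of $H_i$ with exceptional eigenvalue $e^{2\pi\sqrt{-1}/|G_i|}$. $H_i\pitchfork H_j$ ($i\ne j$) means $\{k:H_i\cap H_j\subset H_k\}=\{i,j\}$; a codimension-2 edge is crossing if it is $H_i\cap H_j$ with $H_i\pitchfork H_j$, noncrossing otherwise; $V_w$ is the fixed space of $w$. Admissible $\Upsilon=\{\mu_s,\tau_i\}$: $\mu_s\ne0$ constant on conjugacy classes of $R$, $\tau_i$ constant on $G$-orbits of $P$. $B_G(\Upsilon)$: unital $\mathbb C$-algebra generated by $T_w$ ($w\in G$, $T_1=1$) and $e_i$ ($i\in P$) with relations (0) $T_{w_1}T_{w_2}=T_{w_1w_2}$;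 (1) $T_{s_i}e_i=e_iT_{s_i}=e_i$; (1') $T_we_i=e_iT_w=e_i$ if $w(H_i)=H_i$ and $H_i\cap V_w$ is a noncrossing codimension-2 edge; (2) $e_i^2=\tau_ie_i$; (3) $T_we_j=e_iT_w$ if $w(H_j)=H_i$; (4) $e_ie_j=e_je_i$ if $H_i\pitchfork H_j$; (5) $e_ie_j=(\sum_{s\in R(i,j)}\mu_sT_s)e_j=e_i(\sum_{s\in R(i,j)}\mu_sT_s)$ if $i\neq j$, $H_i\cap H_j$ noncrossing, $R(i,j)\ne\emptyset$; (6) $e_ie_j=0$ if $i\ne j$, $H_i\cap H_j$ noncrossing, $R(i,j)=\emptyset$. *)

theory Defs
  imports "HOL-Analysis.Analysis"
begin

type_synonym 'n cmat = "complex^'n^'n"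
type_synonym 'n hyp = "(complex^'n) set"

text \<open>Unitary matrices: the conjugate transpose is a left inverse.\<close>
definition unitary :: "'n::finite cmat \<Rightarrow> bool" where
  "unitary A \<longleftrightarrow> (\<chi> i j. cnj (A $ j $ i)) ** A = mat 1"

definition fixspace :: "'n::finite cmat \<Rightarrow> 'n hyp" where
  "fixspace w = {v. w *v v = v}"

text \<open>A (complex linear) hyperplane: kernel of a nonzero linear functional.\<close>
definition is_hyperplane :: "'n::finite hyp \<Rightarrow> bool" where
  "is_hyperplane H \<longleftrightarrow> (\<exists>a::complex^'n. a \<noteq> 0 \<and> H = {v. (\<Sum>k\<in>UNIV. a $ k * v $ k) = 0})"

text \<open>Pseudo reflections of G: non-identity elements fixing a hyperplane pointwise.\<close>
definition prefl :: "'n::finite cmat set \<Rightarrow> 'n cmat set" where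
  "prefl G = {s\<in>G. s \<noteq> mat 1 \<and> is_hyperplane (fixspace s)}"

text \<open>G is a finite subgroup of U(V) generated by its pseudo reflections.\<close>
definition pseudo_reflection_group :: "'n::finite cmat set \<Rightarrow> bool" where
  "pseudo_reflection_group G \<longleftrightarrow> finite G \<and> (\<forall>g\<in>G. unitary g)
     \<and> mat 1 \<in> G \<and> (\<forall>g\<in>G. \<forall>h\<in>G. g ** h \<in> G)
     \<and> G = {foldr (**) l (mat 1) | l. set l \<subseteq> prefl G}"

text \<open>Reflecting hyperplanes (the index set P is the set of hyperplanes itself).\<close>
definition hyps :: "'n::finite cmat set \<Rightarrow> 'n hyp set" where
  "hyps G = fixspace ` prefl G"

definition act :: "'n::finite cmat \<Rightarrow> 'n hyp \<Rightarrow> 'n hyp" where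
  "act w H = (\<lambda>v. w *v v) ` H"

definition Rij :: "'n::finite cmat set \<Rightarrow> 'n hyp \<Rightarrow> 'n hyp \<Rightarrow> 'n cmat set" where
  "Rij G Hi Hj = {s \<in> prefl G. act s Hj = Hi}"

text \<open>Pointwise stabilizer G_i and its distinguished generator s_i.\<close>
definition stab :: "'n::finite cmat set \<Rightarrow> 'n hyp \<Rightarrow> 'n cmat set" where
  "stab G H = {g\<in>G. \<forall>v\<in>H. g *v v = v}"

definition sgen :: "'n::finite cmat set \<Rightarrow> 'n hyp \<Rightarrow> 'n cmat" where
  "sgen G H = (THE s. s \<in> stab G H \<and>
     (\<exists>v. v \<noteq> 0 \<and> s *v v = exp (2 * pi * \<i> / of_nat (card (stab G H))) *s v))"

text \<open>Set of hyperplanes of the arrangement containing a subspace X.\<close>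
definition above :: "'n::finite cmat set \<Rightarrow> 'n hyp \<Rightarrow> 'n hyp set" where
  "above G X = {K \<in> hyps G. X \<subseteq> K}"

definition transversal :: "'n::finite cmat set \<Rightarrow> 'n hyp \<Rightarrow> 'n hyp \<Rightarrow> bool" where
  "transversal G Hi Hj \<longleftrightarrow> Hi \<noteq> Hj \<and> above G (Hi \<inter> Hj) = {Hi, Hj}"

text \<open>Codimension-2 edges are intersections of two distinct reflecting hyperplanes.\<close>
definition codim2_edge :: "'n::finite cmat set \<Rightarrow> 'n hyp \<Rightarrow> bool" where
  "codim2_edge G X \<longleftrightarrow> (\<exists>Hi\<in>hyps G. \<exists>Hj\<in>hyps G. Hi \<noteq> Hj \<and> X = Hi \<inter> Hj)"

definition crossing_edge :: "'n::finite cmat set \<Rightarrow> 'n hyp \<Rightarrow> bool" where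
  "crossing_edge G X \<longleftrightarrow> (\<exists>Hi\<in>hyps G. \<exists>Hj\<in>hyps G. transversal G Hi Hj \<and> X = Hi \<inter> Hj)"

definition noncrossing_edge :: "'n::finite cmat set \<Rightarrow> 'n hyp \<Rightarrow> bool" where
  "noncrossing_edge G X \<longleftrightarrow> codim2_edge G X \<and> \<not> crossing_edge G X"

text \<open>Admissible parameters.\<close>
definition admissible :: "'n::finite cmat set \<Rightarrow> ('n cmat \<Rightarrow> complex) \<Rightarrow> ('n hyp \<Rightarrow> complex) \<Rightarrow> bool" where
  "admissible G mu tau \<longleftrightarrow>
     (\<forall>s\<in>prefl G. mu s \<noteq> 0) \<and>
     (\<forall>s\<in>prefl G. \<forall>g\<in>G. mu (g ** s ** matrix_inv g) = mu s) \<and>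
     (\<forall>H\<in>hyps G. \<forall>w\<in>G. tau (act w H) = tau H)"

text \<open>Endomorphisms of V_G = free C-module on the hyperplanes, as matrices indexed by hyperplanes
  (entry (k,j) = coefficient of v_k in the image of v_j).\<close>
type_synonym 'n endo = "'n hyp \<Rightarrow> 'n hyp \<Rightarrow> complex"

definition emul :: "'n::finite cmat set \<Rightarrow> 'n endo \<Rightarrow> 'n endo \<Rightarrow> 'n endo" where
  "emul G A B = (\<lambda>i j. \<Sum>k\<in>hyps G. A i k * B k j)"

definition eone :: "'n::finite endo" where
  "eone = (\<lambda>i j. if i = j then 1 else 0)"

definition ezero :: "'n::finite endo" where
  "ezero = (\<lambda>i j. 0)"

definition esmult :: "complex \<Rightarrow> 'n::finite endo \<Rightarrow> 'n endo" where
  "esmult c A = (\<lambda>i j. c * A i j)"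

text \<open>Equality in End(V_G): entries indexed by P x P agree.\<close>
definition eeq :: "'n::finite cmat set \<Rightarrow> 'n endo \<Rightarrow> 'n endo \<Rightarrow> bool" where
  "eeq G A B \<longleftrightarrow> (\<forall>i\<in>hyps G. \<forall>j\<in>hyps G. A i j = B i j)"

text \<open>iota(w) v_i = v_{w(i)}.\<close>
definition iota :: "'n::finite cmat \<Rightarrow> 'n endo" where
  "iota w = (\<lambda>k i. if k = act w i then 1 else 0)"

definition alpha :: "'n::finite cmat set \<Rightarrow> ('n cmat \<Rightarrow> complex) \<Rightarrow> 'n hyp \<Rightarrow> 'n hyp \<Rightarrow> complex" where
  "alpha G mu Hi Hj = (\<Sum>s\<in>Rij G Hi Hj. mu s)"

text \<open>p_i v_i = tau_i v_i, p_i v_j = alpha_{i,j} v_i for j /= i.\<close>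
definition pmap :: "'n::finite cmat set \<Rightarrow> ('n cmat \<Rightarrow> complex) \<Rightarrow> ('n hyp \<Rightarrow> complex) \<Rightarrow> 'n hyp \<Rightarrow> 'n endo" where
  "pmap G mu tau Hi = (\<lambda>k j. if k = Hi then (if j = Hi then tau Hi else alpha G mu Hi j) else 0)"

text \<open>The element sum_{s in R(i,j)} mu_s T_s, mapped to End(V_G).\<close>
definition rsum :: "'n::finite cmat set \<Rightarrow> ('n cmat \<Rightarrow> complex) \<Rightarrow> 'n hyp \<Rightarrow> 'n hyp \<Rightarrow> 'n endo" where
  "rsum G mu Hi Hj = (\<lambda>k l. \<Sum>s\<in>Rij G Hi Hj. mu s * iota s k l)"

text \<open>Families (Tw, e) in End(V_G) satisfying the defining relations (0)-(6) of B_G(Upsilon);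
  by the universal property of the presentation these are exactly the algebra
  homomorphisms B_G(Upsilon) -> End(V_G).\<close>
definition satisfies_BG_relations ::
  "'n::finite cmat set \<Rightarrow> ('n cmat \<Rightarrow> complex) \<Rightarrow> ('n hyp \<Rightarrow> complex)
    \<Rightarrow> ('n cmat \<Rightarrow> 'n endo) \<Rightarrow> ('n hyp \<Rightarrow> 'n endo) \<Rightarrow> bool" where
  "satisfies_BG_relations G mu tau T e \<longleftrightarrow>
    eeq G (T (mat 1)) eone \<and>
    (\<forall>w1\<in>G. \<forall>w2\<in>G. eeq G (emul G (T w1) (T w2)) (T (w1 ** w2))) \<and>
    (\<forall>i\<in>hyps G. eeq G (emul G (T (sgen G i)) (e i)) (e i)
                \<and> eeq G (emul G (e i) (T (sgen G i))) (e i)) \<and>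
    (\<forall>i\<in>hyps G. \<forall>w\<in>G. act w i = i \<and> noncrossing_edge G (i \<inter> fixspace w) \<longrightarrow>
        eeq G (emul G (T w) (e i)) (e i) \<and> eeq G (emul G (e i) (T w)) (e i)) \<and>
    (\<forall>i\<in>hyps G. eeq G (emul G (e i) (e i)) (esmult (tau i) (e i))) \<and>
    (\<forall>i\<in>hyps G. \<forall>j\<in>hyps G. \<forall>w\<in>G. act w j = i \<longrightarrow>
        eeq G (emul G (T w) (e j)) (emul G (e i) (T w))) \<and>
    (\<forall>i\<in>hyps G. \<forall>j\<in>hyps G. transversal G i j \<longrightarrow>
        eeq G (emul G (e i) (e j)) (emul G (e j) (e i))) \<and>
    (\<forall>i\<in>hyps G. \<forall>j\<in>hyps G. i \<noteq> j \<and> noncrossing_edge G (i \<inter> j) \<and> Rij G i j \<noteq> {} \<longrightarrow>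
        eeq G (emul G (e i) (e j)) (emul G (rsum G mu i j) (e j)) \<and>
        eeq G (emul G (e i) (e j)) (emul G (e i) (rsum G mu i j))) \<and>
    (\<forall>i\<in>hyps G. \<forall>j\<in>hyps G. i \<noteq> j \<and> noncrossing_edge G (i \<inter> j) \<and> Rij G i j = {} \<longrightarrow>
        eeq G (emul G (e i) (e j)) ezero)"

end

theory Submission
  imports Defs
begin

(*
  In the basis (v_i) the map iota(w) permutes coordinates, p_i has a single nonzero row, and
  every relation reduces to an identity between entries.  Two geometric facts drive these
  identities.  First, s_i is well defined and fixes H_i: the pointwise stabiliser G_i acts on
  the normal line of H_i through an injective character, whose finite image, a subgroup of
  the complex units of order |G_i|, is the group of all |G_i|-th roots of unity; so exactly
  one element of G_i has eigenvalue exp(2 pi i/|G_i|).  Second, R(i,j) is empty whenever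
  H_i and H_j are transversal: a reflection s with s(H_j) = H_i, H_i <> H_j, moves vectors
  only along the normal of its own hyperplane and therefore fixes H_i \<inter> H_j, so
  its hyperplane would be a third reflecting hyperplane containing H_i \<inter> H_j.  The rest uses only
  that tau and alpha are G-invariant, the latter because mu is a class function.
*)

section \<open>The standard Hermitian form\<close>

definition cinner :: "complex^'n::finite \<Rightarrow> complex^'n \<Rightarrow> complex" where
  "cinner x y = (\<Sum>k\<in>UNIV. cnj (x$k) * y$k)"

definition ctranspose :: "'n::finite cmat \<Rightarrow> 'n cmat" where
  "ctranspose A = (\<chi> i j. cnj (A $ j $ i))"

lemma cinner_add_right: "cinner x (y + z) = cinner x y + cinner x z"
  by (simp add: cinner_def sum.distrib distrib_left)

lemma cinner_diff_right: "cinner x (y - z) = cinner x y - cinner x z"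
  by (simp add: cinner_def sum_subtractf right_diff_distrib)

lemma cinner_diff_left: "cinner (x - y) z = cinner x z - cinner y z"
  by (simp add: cinner_def sum_subtractf left_diff_distrib)

lemma cinner_smult_right: "cinner x (c *s y) = c * cinner x y"
  by (simp add: cinner_def sum_distrib_left mult_ac)

lemma cinner_smult_left: "cinner (c *s x) y = cnj c * cinner x y"
  by (simp add: cinner_def sum_distrib_left mult_ac)

lemma cinner_self_eq_0 [simp]: "cinner x x = 0 \<longleftrightarrow> x = 0"
proof
  assume "cinner x x = 0"
  moreover have "cinner x x = of_real (\<Sum>k\<in>UNIV. (norm (x$k))^2)"
    unfolding cinner_def of_real_sum
    by (rule sum.cong) (simp_all add: complex_norm_square mult.commute del: of_real_power)
  ultimately have "(\<Sum>k\<in>UNIV. (norm (x$k))^2) = 0"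
    by (metis of_real_eq_0_iff)
  then show "x = 0"
    by (simp add: sum_nonneg_eq_0_iff vec_eq_iff)
qed (simp add: cinner_def)

lemma cinner_matrix_left: "cinner (A *v x) y = cinner x (ctranspose A *v y)"
proof -
  have "cinner (A *v x) y = (\<Sum>k\<in>UNIV. \<Sum>l\<in>UNIV. cnj (A$k$l) * cnj (x$l) * y$k)"
    unfolding cinner_def matrix_vector_mult_def
    by (intro sum.cong refl) (simp add: sum_distrib_right sum_distrib_left mult_ac)
  also have "\<dots> = (\<Sum>l\<in>UNIV. \<Sum>k\<in>UNIV. cnj (A$k$l) * cnj (x$l) * y$k)"
    by (rule sum.swap)
  also have "\<dots> = cinner x (ctranspose A *v y)"
    unfolding cinner_def ctranspose_def matrix_vector_mult_def
    by (intro sum.cong refl) (simp add: sum_distrib_right sum_distrib_left mult_ac)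
  finally show ?thesis .
qed

lemma ctranspose_ctranspose [simp]: "ctranspose (ctranspose A) = A"
  by (simp add: ctranspose_def vec_eq_iff)

lemma unitary_iff_ctranspose: "unitary A \<longleftrightarrow> ctranspose A ** A = mat 1"
  by (simp add: unitary_def ctranspose_def)

lemma unitary_cinner:
  assumes "unitary g"
  shows "cinner (g *v x) (g *v y) = cinner x y"
  using assms by (simp add: cinner_matrix_left matrix_vector_mul_assoc unitary_iff_ctranspose)

lemma is_hyperplane_iff_cinner:
  fixes H :: "'n::finite hyp"
  shows "is_hyperplane H \<longleftrightarrow> (\<exists>u. u \<noteq> 0 \<and> H = {v. cinner u v = 0})"
proof -
  define cv :: "complex^'n \<Rightarrow> complex^'n" where "cv a = (\<chi> k. cnj (a$k))" for a
  have cv_cv: "cv (cv a) = a" for a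
    by (simp add: cv_def vec_eq_iff)
  have cv_0: "cv a = 0 \<longleftrightarrow> a = 0" for a
    by (simp add: cv_def vec_eq_iff)
  have "(\<Sum>k\<in>UNIV. a $ k * v $ k) = cinner (cv a) v" for a v
    by (simp add: cinner_def cv_def)
  note lin = this
  show ?thesis
    unfolding is_hyperplane_def lin
  proof safe
    fix a :: "complex^'n" assume "a \<noteq> 0"
    then show "\<exists>u. u \<noteq> 0 \<and> {v. cinner (cv a) v = 0} = {v. cinner u v = 0}"
      using cv_0 by blast
  next
    fix u :: "complex^'n" assume "u \<noteq> 0"
    then show "\<exists>a. a \<noteq> 0 \<and> {v. cinner u v = 0} = {v. cinner (cv a) v = 0}"
      by (intro exI[of _ "cv u"]) (simp add: cv_cv cv_0)
  qed
qed

lemma orthogonal_to_hyperplane: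
  assumes "u \<noteq> 0" and "\<And>x. cinner u x = 0 \<Longrightarrow> cinner z x = 0"
  shows "z = (cinner u z / cinner u u) *s u"
proof -
  define y where "y = z - (cinner u z / cinner u u) *s u"
  have "cinner u y = 0"
    using assms(1) by (simp add: y_def cinner_diff_right cinner_smult_right)
  moreover from this have "cinner z y = 0"
    using assms(2) by blast
  ultimately have "cinner y y = 0"
    by (simp add: y_def cinner_diff_left cinner_smult_left)
  then show ?thesis
    by (simp add: y_def)
qed

lemma hyperplane_subset_imp_eq:
  assumes "u \<noteq> 0" "w \<noteq> 0" and sub: "{v. cinner u v = 0} \<subseteq> {v. cinner w v = 0}"
  shows "{v. cinner u v = 0} = {v. cinner w v = 0}"
proof -
  define c where "c = cinner u w / cinner u u"
  have "w = c *s u"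
    unfolding c_def using assms(1) sub by (intro orthogonal_to_hyperplane) blast+
  with assms(2) have "c \<noteq> 0" by auto
  have "cinner w v = cnj c * cinner u v" for v
    using \<open>w = c *s u\<close> by (simp add: cinner_smult_left)
  with \<open>c \<noteq> 0\<close> show ?thesis
    by (simp add: set_eq_iff)
qed

section \<open>Unitary matrices fixing a hyperplane pointwise\<close>

definition normal_eigenvalue :: "complex^'n::finite \<Rightarrow> 'n cmat \<Rightarrow> complex" where
  "normal_eigenvalue u g = cinner u (g *v u) / cinner u u"

lemma normal_eigenvalue_eqI:
  assumes "u \<noteq> 0" "g *v u = c *s u"
  shows "normal_eigenvalue u g = c"
  using assms by (simp add: normal_eigenvalue_def cinner_smult_right)

lemma unitary_fixing_hyperplane_apply:
  assumes "unitary g" "u \<noteq> 0" and fixed: "\<And>x. cinner u x = 0 \<Longrightarrow> g *v x = x"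
  shows "g *v v = v + (cinner u v / cinner u u * (normal_eigenvalue u g - 1)) *s u"
proof -
  have moves_along_u: "g *v y - y = (cinner u (g *v y - y) / cinner u u) *s u" for y
  proof (rule orthogonal_to_hyperplane[OF assms(2)])
    fix x assume "cinner u x = 0"
    then have "cinner (g *v y) x = cinner (g *v y) (g *v x)"
      using fixed by simp
    then show "cinner (g *v y - y) x = 0"
      using unitary_cinner[OF assms(1)] by (simp add: cinner_diff_left)
  qed
  define t where "t = cinner u v / cinner u u"
  define x where "x = v - t *s u"
  have "cinner u x = 0"
    using assms(2) by (simp add: x_def t_def cinner_diff_right cinner_smult_right)
  then have "g *v x = x"
    by (rule fixed)
  have "cinner u u \<noteq> 0"
    using assms(2) by simp
  then have "g *v u - u = (normal_eigenvalue u g - 1) *s u"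
    using moves_along_u[of u] by (simp add: normal_eigenvalue_def cinner_diff_right diff_divide_distrib)
  then have "g *v u = normal_eigenvalue u g *s u"
    by (simp add: vec_eq_iff algebra_simps)
  have "v = x + t *s u"
    by (simp add: x_def)
  then have "g *v v = g *v x + t *s (g *v u)"
    by (metis matrix_vector_right_distrib vector_scalar_commute)
  also have "\<dots> = x + t *s (normal_eigenvalue u g *s u)"
    using \<open>g *v x = x\<close> \<open>g *v u = _\<close> by simp
  also have "\<dots> = v + (t * (normal_eigenvalue u g - 1)) *s u"
    by (simp add: x_def vec_eq_iff algebra_simps)
  finally show ?thesis
    by (simp add: t_def)
qed

lemma unitary_fixing_hyperplane_normal:
  assumes "unitary g" "u \<noteq> 0" "\<And>x. cinner u x = 0 \<Longrightarrow> g *v x = x"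
  shows "g *v u = normal_eigenvalue u g *s u"
proof -
  have "cinner u u / cinner u u = 1"
    using assms(2) by simp
  then have "g *v u = u + (normal_eigenvalue u g - 1) *s u"
    using unitary_fixing_hyperplane_apply[OF assms, of u] by simp
  then show ?thesis
    by (simp add: vec_eq_iff algebra_simps)
qed

lemma unitary_fixing_hyperplane_eqI:
  assumes "unitary g" "unitary h" "u \<noteq> 0"
    and "\<And>x. cinner u x = 0 \<Longrightarrow> g *v x = x" "\<And>x. cinner u x = 0 \<Longrightarrow> h *v x = x"
    and "normal_eigenvalue u g = normal_eigenvalue u h"
  shows "g = h"
  using unitary_fixing_hyperplane_apply[OF assms(1,3,4)] unitary_fixing_hyperplane_apply[OF assms(2,3,5)]
    assms(6) by (simp add: matrix_eq)

lemma unitary_fixing_hyperplane_eigenvalue: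
  assumes "unitary g" "u \<noteq> 0" "\<And>x. cinner u x = 0 \<Longrightarrow> g *v x = x"
    and "g *v v = c *s v" "v \<noteq> 0" "c \<noteq> 1"
  shows "normal_eigenvalue u g = c"
proof -
  define t where "t = cinner u v / cinner u u"
  have eq: "c *s v = v + (t * (normal_eigenvalue u g - 1)) *s u"
    using unitary_fixing_hyperplane_apply[OF assms(1-3), of v] assms(4) by (simp add: t_def)
  have "cinner u v \<noteq> 0"
  proof
    assume "cinner u v = 0"
    then have "(c - 1) *s v = 0"
      using eq by (simp add: t_def vec_eq_iff algebra_simps)
    with assms(5,6) show False
      by (simp add: vec_eq_iff)
  qed
  have "c * cinner u v = cinner u v + t * (normal_eigenvalue u g - 1) * cinner u u"
    using arg_cong[OF eq, of "cinner u"] by (simp add: cinner_add_right cinner_smult_right)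
  also have "\<dots> = normal_eigenvalue u g * cinner u v"
    using assms(2) by (simp add: t_def field_simps)
  finally show ?thesis
    using \<open>cinner u v \<noteq> 0\<close> by simp
qed

text \<open>Multiplication by an element permutes the finite set, so it scales the product of all
  its elements by the m-th power of that element.\<close>
lemma finite_mult_closed_eq_roots_unity:
  fixes L :: "complex set"
  assumes "finite L" "L \<noteq> {}" "0 \<notin> L" and closed: "\<And>a b. a \<in> L \<Longrightarrow> b \<in> L \<Longrightarrow> a * b \<in> L"
  shows "L = {z. z ^ card L = 1}"
proof (rule card_subset_eq)
  have "card L > 0"
    using assms(1,2) by (simp add: card_gt_0_iff)
  then show "finite {z::complex. z ^ card L = 1}" "card L = card {z::complex. z ^ card L = 1}"
    by (simp_all add: finite_roots_unity card_roots_unity_eq)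
  show "L \<subseteq> {z. z ^ card L = 1}"
  proof
    fix c assume c: "c \<in> L"
    then have "inj_on ((*) c) L"
      using assms(3) by (auto simp: inj_on_def)
    moreover have "(*) c ` L = L"
      using c closed \<open>inj_on _ L\<close> by (intro endo_inj_surj[OF assms(1)]) auto
    ultimately have "prod id L = c ^ card L * prod id L"
      using prod.reindex[of "(*) c" L id] by (simp add: prod.distrib)
    moreover have "prod id L \<noteq> 0"
      using assms(1,3) by auto
    ultimately show "c \<in> {z. z ^ card L = 1}"
      by simp
  qed
qed

lemma exp_two_pi_div_root_unity:
  assumes "m \<ge> 2"
  shows "exp (2 * pi * \<i> / of_nat m) ^ m = 1" "exp (2 * pi * \<i> / of_nat m) \<noteq> 1"
  using complex_root_unity[of m 1] complex_root_unity_eq_1[of m 1] assms by simp_all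

section \<open>Finite pseudo-reflection groups\<close>

lemma matrix_inv_unique:
  fixes A B :: "'a::comm_ring_1^'n::finite^'n"
  assumes "A ** B = mat 1" "B ** A = mat 1"
  shows "matrix_inv A = B"
proof -
  have "A ** matrix_inv A = mat 1 \<and> matrix_inv A ** A = mat 1"
    unfolding matrix_inv_def by (rule someI[of _ B]) (simp add: assms)
  then have "matrix_inv A = (matrix_inv A ** A) ** B"
    by (metis assms(1) matrix_mul_assoc matrix_mul_rid)
  then show ?thesis
    by (simp add: \<open>_ \<and> matrix_inv A ** A = mat 1\<close>)
qed

lemma act_mult: "act (A ** B) H = act A (act B H)"
  by (simp add: act_def image_image matrix_vector_mul_assoc)

lemma act_mat1 [simp]: "act (mat 1) H = H"
  by (simp add: act_def)

lemma act_fixspace: "act s (fixspace s) = fixspace s"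
  unfolding act_def fixspace_def by (simp add: image_cong[OF refl, of _ "\<lambda>v. v"])

lemma act_stab: "g \<in> stab G H \<Longrightarrow> act g H = H"
  unfolding act_def stab_def by (simp add: image_cong[OF refl, of _ "\<lambda>v. v"])

locale reflection_group =
  fixes G :: "'n::finite cmat set"
  assumes pseudo_reflection_group: "pseudo_reflection_group G"
begin

lemma finite_G: "finite G"
  using pseudo_reflection_group by (simp add: pseudo_reflection_group_def)

lemma mat1_in_G: "mat 1 \<in> G"
  using pseudo_reflection_group by (simp add: pseudo_reflection_group_def)

lemma mult_in_G: "g \<in> G \<Longrightarrow> h \<in> G \<Longrightarrow> g ** h \<in> G"
  using pseudo_reflection_group by (simp add: pseudo_reflection_group_def)

lemma ctranspose_mult_self: "g \<in> G \<Longrightarrow> ctranspose g ** g = mat 1"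
  using pseudo_reflection_group by (simp add: pseudo_reflection_group_def unitary_iff_ctranspose)

lemma mult_ctranspose_self: "g \<in> G \<Longrightarrow> g ** ctranspose g = mat 1"
  using ctranspose_mult_self matrix_left_right_inverse by blast

lemma unitary_G: "g \<in> G \<Longrightarrow> unitary g"
  by (simp add: unitary_iff_ctranspose ctranspose_mult_self)

text \<open>Left multiplication by g is injective on the finite set G, hence onto, so G contains a
  right inverse of g, which must be the left inverse ctranspose g.\<close>
lemma ctranspose_in_G:
  assumes "g \<in> G"
  shows "ctranspose g \<in> G"
proof -
  have "inj_on ((**) g) G"
  proof
    fix x y assume "g ** x = g ** y"
    then have "(ctranspose g ** g) ** x = (ctranspose g ** g) ** y"
      by (metis matrix_mul_assoc)
    then show "x = y"
      by (simp add: ctranspose_mult_self[OF assms])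
  qed
  then have "(**) g ` G = G"
    using assms by (intro endo_inj_surj finite_G) (auto intro: mult_in_G)
  then obtain h where "h \<in> G" "g ** h = mat 1"
    using mat1_in_G by (metis imageE)
  moreover have "ctranspose g = (ctranspose g ** g) ** h"
    by (metis \<open>g ** h = mat 1\<close> matrix_mul_assoc matrix_mul_rid)
  ultimately show ?thesis
    by (simp add: ctranspose_mult_self[OF assms])
qed

lemma matrix_inv_G: "g \<in> G \<Longrightarrow> matrix_inv g = ctranspose g"
  by (simp add: matrix_inv_unique mult_ctranspose_self ctranspose_mult_self)

lemma ctranspose_apply [simp]: "g \<in> G \<Longrightarrow> ctranspose g *v (g *v y) = y"
  by (simp add: matrix_vector_mul_assoc ctranspose_mult_self)

lemma apply_ctranspose [simp]: "g \<in> G \<Longrightarrow> g *v (ctranspose g *v y) = y"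
  by (simp add: matrix_vector_mul_assoc mult_ctranspose_self)

lemma act_ctranspose_act [simp]: "g \<in> G \<Longrightarrow> act (ctranspose g) (act g H) = H"
  by (simp flip: act_mult add: ctranspose_mult_self)

lemma act_eq_iff: "g \<in> G \<Longrightarrow> act g X = act g Y \<longleftrightarrow> X = Y"
  by (metis act_ctranspose_act)

lemma mem_act_iff: "g \<in> G \<Longrightarrow> y \<in> act g H \<longleftrightarrow> ctranspose g *v y \<in> H"
  unfolding act_def by (metis ctranspose_apply apply_ctranspose image_iff)

lemma fixspace_conj:
  assumes "g \<in> G"
  shows "fixspace (g ** s ** ctranspose g) = act g (fixspace s)"
proof -
  have "g *v (s *v (ctranspose g *v v)) = v \<longleftrightarrow> s *v (ctranspose g *v v) = ctranspose g *v v" for v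
    using assms by (metis ctranspose_apply apply_ctranspose)
  then show ?thesis
    using assms by (simp add: set_eq_iff fixspace_def mem_act_iff flip: matrix_vector_mul_assoc)
qed

lemma is_hyperplane_act:
  assumes "g \<in> G" "is_hyperplane H"
  shows "is_hyperplane (act g H)"
proof -
  obtain u where u: "u \<noteq> 0" "H = {v. cinner u v = 0}"
    using assms(2) is_hyperplane_iff_cinner by blast
  have "act g H = {y. cinner (g *v u) y = 0}"
    using assms(1) u(2) by (auto simp: mem_act_iff cinner_matrix_left)
  moreover have "g *v u \<noteq> 0"
    using assms(1) u(1) by (metis ctranspose_apply matrix_vector_mult_0_right)
  ultimately show ?thesis
    using is_hyperplane_iff_cinner by blast
qed

lemma prefl_in_G: "s \<in> prefl G \<Longrightarrow> s \<in> G"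
  by (simp add: prefl_def)

lemma conj_in_prefl:
  assumes "g \<in> G" "s \<in> prefl G"
  shows "g ** s ** ctranspose g \<in> prefl G"
proof -
  have s: "s \<in> G" "s \<noteq> mat 1" "is_hyperplane (fixspace s)"
    using assms(2) by (auto simp: prefl_def)
  have "ctranspose g ** (g ** s ** ctranspose g) ** g = s"
    using assms(1) ctranspose_mult_self mult_ctranspose_self
    by (metis matrix_mul_assoc matrix_mul_lid matrix_mul_rid)
  then have "g ** s ** ctranspose g \<noteq> mat 1"
    using assms(1) s(2) by (auto simp: ctranspose_mult_self)
  then show ?thesis
    using assms(1) s fixspace_conj is_hyperplane_act
    by (simp add: prefl_def mult_in_G ctranspose_in_G)
qed

lemma act_in_hyps:
  assumes "g \<in> G" "H \<in> hyps G"
  shows "act g H \<in> hyps G"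
  using assms fixspace_conj conj_in_prefl by (auto simp: hyps_def simp flip: fixspace_conj)

lemma finite_hyps: "finite (hyps G)"
  using finite_G by (simp add: hyps_def prefl_def)

lemma Rij_memD: "s \<in> Rij G i j \<Longrightarrow> s \<in> G \<and> act s j = i"
  by (simp add: Rij_def prefl_in_G)

lemma conj_in_Rij:
  assumes "w \<in> G" "r \<in> Rij G i j"
  shows "w ** r ** ctranspose w \<in> Rij G (act w i) (act w j)"
  using assms by (auto simp: Rij_def conj_in_prefl act_mult)

lemma conj_ctranspose_cancel: "w \<in> G \<Longrightarrow> ctranspose w ** (w ** r ** ctranspose w) ** w = r"
  by (metis ctranspose_mult_self mult_ctranspose_self matrix_mul_assoc matrix_mul_lid matrix_mul_rid)

lemma stab_apply_normal:
  assumes "u \<noteq> 0" "g \<in> stab G {v. cinner u v = 0}"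
  shows "g *v u = normal_eigenvalue u g *s u"
  using assms by (intro unitary_fixing_hyperplane_normal) (auto simp: stab_def unitary_G)

lemma normal_eigenvalue_stab_mult:
  assumes "u \<noteq> 0" "g \<in> stab G {v. cinner u v = 0}" "h \<in> stab G {v. cinner u v = 0}"
  shows "normal_eigenvalue u (g ** h) = normal_eigenvalue u g * normal_eigenvalue u h"
proof (rule normal_eigenvalue_eqI[OF assms(1)])
  have "(g ** h) *v u = normal_eigenvalue u h *s (g *v u)"
    using stab_apply_normal[OF assms(1,3)] by (simp flip: matrix_vector_mul_assoc add: vector_scalar_commute)
  then show "(g ** h) *v u = (normal_eigenvalue u g * normal_eigenvalue u h) *s u"
    using stab_apply_normal[OF assms(1,2)] by (simp add: vector_smult_assoc mult.commute)
qed

lemma inj_on_normal_eigenvalue_stab: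
  assumes "u \<noteq> 0"
  shows "inj_on (normal_eigenvalue u) (stab G {v. cinner u v = 0})"
  using assms by (intro inj_onI unitary_fixing_hyperplane_eqI) (auto simp: stab_def unitary_G)

lemma normal_eigenvalue_stab_eq_roots_unity:
  assumes "u \<noteq> 0"
  defines "S \<equiv> stab G {v. cinner u v = 0}"
  shows "normal_eigenvalue u ` S = {z. z ^ card S = 1}"
proof -
  let ?L = "normal_eigenvalue u ` S"
  have "finite S"
    using finite_G by (simp add: S_def stab_def)
  moreover have "mat 1 \<in> S"
    using mat1_in_G by (simp add: S_def stab_def)
  moreover have "0 \<notin> ?L"
  proof
    assume "0 \<in> ?L"
    then obtain g where "g \<in> S" "g *v u = 0"
      using stab_apply_normal[OF assms(1)] unfolding S_def by force
    then have "ctranspose g *v (g *v u) = 0"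
      by simp
    with \<open>g \<in> S\<close> show False
      using assms(1) by (simp add: S_def stab_def)
  qed
  moreover have "a * b \<in> ?L" if ab: "a \<in> ?L" "b \<in> ?L" for a b
  proof -
    obtain g h where "g \<in> S" "h \<in> S" "a = normal_eigenvalue u g" "b = normal_eigenvalue u h"
      using ab by blast
    moreover have "g ** h \<in> S"
      using \<open>g \<in> S\<close> \<open>h \<in> S\<close> by (simp add: S_def stab_def mult_in_G flip: matrix_vector_mul_assoc)
    ultimately show ?thesis
      using normal_eigenvalue_stab_mult[OF assms(1)] unfolding S_def by (metis image_eqI)
  qed
  ultimately have "?L = {z. z ^ card ?L = 1}"
    by (intro finite_mult_closed_eq_roots_unity) auto
  then show ?thesis
    using inj_on_normal_eigenvalue_stab[OF assms(1)] by (simp add: card_image S_def)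
qed

lemma sgen_in_stab:
  assumes "H \<in> hyps G"
  shows "sgen G H \<in> stab G H"
proof -
  obtain s0 where s0: "s0 \<in> prefl G" "H = fixspace s0"
    using assms by (auto simp: hyps_def)
  then obtain u where u: "u \<noteq> 0" "H = {v. cinner u v = 0}"
    using is_hyperplane_iff_cinner by (auto simp: prefl_def)
  have fixes_H: "\<And>x. cinner u x = 0 \<Longrightarrow> g *v x = x" if "g \<in> stab G H" for g
    using that u(2) by (simp add: stab_def)
  define m where "m = card (stab G H)"
  define \<zeta> where "\<zeta> = exp (2 * pi * \<i> / of_nat m)"
  have "mat 1 \<in> stab G H" "s0 \<in> stab G H" "finite (stab G H)"
    using s0 mat1_in_G finite_G by (simp_all add: stab_def prefl_def fixspace_def)
  then have "card {mat 1, s0} \<le> m"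
    unfolding m_def by (intro card_mono) auto
  moreover have "mat 1 \<noteq> s0"
    using s0(1) by (auto simp: prefl_def)
  ultimately have "m \<ge> 2"
    by simp
  then have "\<zeta> \<in> normal_eigenvalue u ` stab G H"
    using normal_eigenvalue_stab_eq_roots_unity[OF u(1)] exp_two_pi_div_root_unity(1)
    by (simp add: u(2) m_def \<zeta>_def)
  then obtain g0 where g0: "g0 \<in> stab G H" "normal_eigenvalue u g0 = \<zeta>"
    by blast
  have "\<exists>!s. s \<in> stab G H \<and> (\<exists>v. v \<noteq> 0 \<and> s *v v = \<zeta> *s v)"
  proof
    show "g0 \<in> stab G H \<and> (\<exists>v. v \<noteq> 0 \<and> g0 *v v = \<zeta> *s v)"
      using g0 u stab_apply_normal by blast
  next
    fix s assume s: "s \<in> stab G H \<and> (\<exists>v. v \<noteq> 0 \<and> s *v v = \<zeta> *s v)"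
    then obtain v where "v \<noteq> 0" "s *v v = \<zeta> *s v"
      by blast
    moreover have "unitary s"
      using s by (simp add: stab_def unitary_G)
    moreover have "\<zeta> \<noteq> 1"
      using \<open>m \<ge> 2\<close> exp_two_pi_div_root_unity(2) by (simp add: \<zeta>_def)
    ultimately have "normal_eigenvalue u s = \<zeta>"
      using u(1) fixes_H s by (intro unitary_fixing_hyperplane_eigenvalue) auto
    then show "s = g0"
      using inj_on_normal_eigenvalue_stab[OF u(1)] s g0 u(2) by (simp add: inj_on_def)
  qed
  then have "(THE s. s \<in> stab G H \<and> (\<exists>v. v \<noteq> 0 \<and> s *v v = \<zeta> *s v)) \<in> stab G H"
    by (rule theI'[THEN conjunct1])
  then show ?thesis
    by (simp add: sgen_def m_def \<zeta>_def)
qed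

lemma sgen_fixes_hyperplane:
  assumes "H \<in> hyps G"
  shows "sgen G H \<in> G" "act (sgen G H) H = H"
  using sgen_in_stab[OF assms] act_stab by (simp_all add: stab_def)

lemma reflection_fixes_intersection:
  assumes "s \<in> prefl G" "i \<in> hyps G" "j \<in> hyps G" "i \<noteq> j" "act s j = i"
  shows "i \<inter> j \<subseteq> fixspace s"
proof -
  obtain a where a: "a \<noteq> 0" "fixspace s = {v. cinner a v = 0}"
    using assms(1) is_hyperplane_iff_cinner by (auto simp: prefl_def)
  obtain c where c: "c \<noteq> 0" "i = {v. cinner c v = 0}"
    using assms(2) is_hyperplane_iff_cinner by (auto simp: hyps_def prefl_def)
  define \<kappa> where "\<kappa> v = cinner a v / cinner a a * (normal_eigenvalue a s - 1)" for v
  have "unitary s"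
    using assms(1) by (simp add: prefl_in_G unitary_G)
  moreover have "\<And>x. cinner a x = 0 \<Longrightarrow> s *v x = x"
    using a(2) by (auto simp: fixspace_def)
  ultimately have \<kappa>: "s *v v = v + \<kappa> v *s a" for v
    unfolding \<kappa>_def by (rule unitary_fixing_hyperplane_apply[OF _ a(1)])
  have maps_into: "cinner c (s *v x) = 0" if "x \<in> j" for x
    using that assms(5) c(2) by (auto simp: act_def)
  have shift: "cinner c (s *v v) = cinner c v + \<kappa> v * cinner c a" for v
    by (simp add: \<kappa> cinner_add_right cinner_smult_right)
  have "cinner c a \<noteq> 0"
  proof
    assume "cinner c a = 0"
    then have "j \<subseteq> i"
      using maps_into shift c(2) by auto
    moreover obtain b where "b \<noteq> 0" "j = {v. cinner b v = 0}"
      using assms(3) is_hyperplane_iff_cinner by (auto simp: hyps_def prefl_def)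
    ultimately have "j = i"
      using hyperplane_subset_imp_eq[of b c] c by simp
    with assms(4) show False
      by simp
  qed
  show ?thesis
  proof
    fix v assume v: "v \<in> i \<inter> j"
    then have "\<kappa> v * cinner c a = 0"
      using maps_into[of v] shift[of v] c(2) by simp
    then have "\<kappa> v = 0"
      using \<open>cinner c a \<noteq> 0\<close> by simp
    then show "v \<in> fixspace s"
      by (simp add: fixspace_def \<kappa>)
  qed
qed

lemma Rij_empty_if_transversal:
  assumes "i \<in> hyps G" "j \<in> hyps G" "transversal G i j"
  shows "Rij G i j = {}"
proof (rule ccontr)
  assume "Rij G i j \<noteq> {}"
  then obtain s where s: "s \<in> prefl G" "act s j = i"
    by (auto simp: Rij_def)
  have "i \<noteq> j" "above G (i \<inter> j) = {i, j}"
    using assms(3) by (auto simp: transversal_def)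
  moreover have "fixspace s \<in> above G (i \<inter> j)"
    using reflection_fixes_intersection[OF s(1) assms(1,2) \<open>i \<noteq> j\<close> s(2)] s(1)
    by (simp add: above_def hyps_def)
  ultimately have "act s i = i \<or> act s j = j"
    using act_fixspace by auto
  then show False
    using s \<open>i \<noteq> j\<close> act_eq_iff[OF prefl_in_G[OF s(1)]] by auto
qed

end

section \<open>The representation on V_G\<close>

lemma sum_mult_delta:
  assumes "finite S"
  shows "(\<Sum>m\<in>S. f m * (if m = a then x else 0)) = (if a \<in> S then f a * x else (0::'a::semiring_0))"
proof -
  have "(\<Sum>m\<in>S. f m * (if m = a then x else 0)) = (\<Sum>m\<in>S. if m = a then f a * x else 0)"
    by (rule sum.cong) auto
  then show ?thesis
    using assms by simp
qed

locale reflection_group_parameters = reflection_group +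
  fixes mu :: "'n::finite cmat \<Rightarrow> complex" and tau :: "'n hyp \<Rightarrow> complex"
  assumes admissible: "admissible G mu tau"
begin

abbreviation p :: "'n hyp \<Rightarrow> 'n endo" where
  "p \<equiv> pmap G mu tau"

lemma tau_act: "w \<in> G \<Longrightarrow> H \<in> hyps G \<Longrightarrow> tau (act w H) = tau H"
  using admissible by (simp add: admissible_def)

text \<open>Conjugation by w is a bijection from R(i,j) onto R(w(i),w(j)), and mu is a class function.\<close>
lemma alpha_act:
  assumes "w \<in> G"
  shows "alpha G mu (act w i) (act w j) = alpha G mu i j"
  unfolding alpha_def
proof (rule sum.reindex_bij_witness[where j="\<lambda>r. ctranspose w ** r ** w" and i="\<lambda>r. w ** r ** ctranspose w"])
  fix r assume r: "r \<in> Rij G (act w i) (act w j)"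
  have w': "ctranspose w \<in> G" "ctranspose (ctranspose w) = w"
    using assms by (simp_all add: ctranspose_in_G)
  show "w ** (ctranspose w ** r ** w) ** ctranspose w = r"
    using conj_ctranspose_cancel[OF w'(1)] w'(2) by simp
  show "ctranspose w ** r ** w \<in> Rij G i j"
    using conj_in_Rij[OF w'(1) r] w'(2) assms by simp
  have "r \<in> prefl G"
    using r by (simp add: Rij_def)
  then show "mu (ctranspose w ** r ** w) = mu r"
    using admissible w' matrix_inv_G[OF w'(1)] unfolding admissible_def by metis
qed (use assms conj_in_Rij conj_ctranspose_cancel in auto)

lemma emul_pmap_right: "i \<in> hyps G \<Longrightarrow> emul G A (p i) k l = A k i * p i i l"
  unfolding emul_def pmap_def by (simp add: sum_mult_delta finite_hyps)

lemma emul_iota_right: "w \<in> G \<Longrightarrow> l \<in> hyps G \<Longrightarrow> emul G A (iota w) k l = A k (act w l)"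
  unfolding emul_def iota_def by (simp add: sum_mult_delta finite_hyps act_in_hyps)

lemma pmap_entry: "p i k l = (if k = i then (if l = i then tau i else alpha G mu i l) else 0)"
  by (simp add: pmap_def)

lemma iota_entry: "iota w k l = (if k = act w l then 1 else 0)"
  by (simp add: iota_def)

lemma pmap_act:
  assumes "w \<in> G" "j \<in> hyps G" "act w j = i"
  shows "p i i (act w l) = p j j l"
proof -
  have "act w l = i \<longleftrightarrow> l = j"
    using act_eq_iff[OF assms(1)] assms(3) by metis
  then show ?thesis
    using alpha_act[OF assms(1), of j l] tau_act[OF assms(1,2)] assms(3) by (auto simp: pmap_entry)
qed

lemma iota_mat1: "eeq G (iota (mat 1)) eone"
  by (simp add: eeq_def iota_def eone_def)

lemma iota_mult: "w1 \<in> G \<Longrightarrow> w2 \<in> G \<Longrightarrow> eeq G (emul G (iota w1) (iota w2)) (iota (w1 ** w2))"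
  by (simp add: eeq_def emul_iota_right iota_entry act_mult)

lemma iota_pmap_intertwine:
  assumes "w \<in> G" "j \<in> hyps G" "act w j = i"
  shows "eeq G (emul G (iota w) (p j)) (emul G (p i) (iota w))"
proof -
  have "i = act w l \<longleftrightarrow> l = j" for l
    using act_eq_iff[OF assms(1)] assms(3) by metis
  then show ?thesis
    using assms pmap_act[OF assms] by (simp add: eeq_def emul_pmap_right emul_iota_right pmap_entry iota_entry)
qed

lemma iota_pmap_absorb:
  assumes "w \<in> G" "i \<in> hyps G" "act w i = i"
  shows "eeq G (emul G (iota w) (p i)) (p i)" "eeq G (emul G (p i) (iota w)) (p i)"
  using assms pmap_act[OF assms] act_eq_iff[OF assms(1)]
  by (simp_all add: eeq_def emul_pmap_right emul_iota_right pmap_entry iota_entry)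

lemma pmap_square: "i \<in> hyps G \<Longrightarrow> eeq G (emul G (p i) (p i)) (esmult (tau i) (p i))"
  by (simp add: eeq_def emul_pmap_right pmap_entry esmult_def)

lemma pmap_mult_Rij_empty:
  assumes "i \<in> hyps G" "j \<in> hyps G" "i \<noteq> j" "Rij G i j = {}"
  shows "eeq G (emul G (p i) (p j)) ezero"
  using assms by (simp add: eeq_def emul_pmap_right pmap_entry ezero_def alpha_def)

lemma pmap_commute_transversal:
  assumes "i \<in> hyps G" "j \<in> hyps G" "transversal G i j"
  shows "eeq G (emul G (p i) (p j)) (emul G (p j) (p i))"
proof -
  have "transversal G j i"
    using assms(3) by (auto simp: transversal_def Int_commute insert_commute)
  then have "Rij G i j = {}" "Rij G j i = {}" "i \<noteq> j"
    using assms Rij_empty_if_transversal by (auto simp: transversal_def)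
  then show ?thesis
    using assms(1,2) by (simp add: eeq_def emul_pmap_right pmap_entry alpha_def)
qed

lemma rsum_column: "rsum G mu i j k j = (if k = i then alpha G mu i j else 0)"
proof -
  have "rsum G mu i j k j = (\<Sum>s\<in>Rij G i j. mu s * (if k = i then 1 else 0))"
    unfolding rsum_def iota_entry using Rij_memD by (intro sum.cong) auto
  then show ?thesis
    by (simp add: alpha_def)
qed

lemma emul_rsum_right:
  assumes "l \<in> hyps G"
  shows "emul G A (rsum G mu i j) k l = (\<Sum>s\<in>Rij G i j. mu s * A k (act s l))"
proof -
  have "emul G A (rsum G mu i j) k l = (\<Sum>s\<in>Rij G i j. mu s * emul G A (iota s) k l)"
    unfolding emul_def rsum_def
    by (simp add: sum_distrib_left sum.swap[of _ "hyps G"] mult.left_commute)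
  also have "\<dots> = (\<Sum>s\<in>Rij G i j. mu s * A k (act s l))"
    using assms Rij_memD by (intro sum.cong) (auto simp: emul_iota_right)
  finally show ?thesis .
qed

lemma pmap_mult_Rij:
  assumes "i \<in> hyps G" "j \<in> hyps G" "i \<noteq> j"
  shows "eeq G (emul G (p i) (p j)) (emul G (rsum G mu i j) (p j))"
    and "eeq G (emul G (p i) (p j)) (emul G (p i) (rsum G mu i j))"
proof -
  show "eeq G (emul G (p i) (p j)) (emul G (rsum G mu i j) (p j))"
    using assms by (simp add: eeq_def emul_pmap_right pmap_entry rsum_column)
  have "(\<Sum>s\<in>Rij G i j. mu s * p i k (act s l)) = (if k = i then alpha G mu i j * p j j l else 0)"
    if "l \<in> hyps G" for k l
  proof -
    have "(\<Sum>s\<in>Rij G i j. mu s * p i k (act s l)) = (\<Sum>s\<in>Rij G i j. mu s * (if k = i then p j j l else 0))"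
      using Rij_memD pmap_act assms(2) by (intro sum.cong) (auto simp: pmap_entry)
    then show ?thesis
      by (simp add: alpha_def sum_distrib_right)
  qed
  then show "eeq G (emul G (p i) (p j)) (emul G (p i) (rsum G mu i j))"
    using assms by (simp add: eeq_def emul_pmap_right emul_rsum_right pmap_entry)
qed

end

theorem theorem5p2:
  fixes G :: "'n::finite cmat set"
    and mu :: "'n cmat \<Rightarrow> complex" and tau :: "'n hyp \<Rightarrow> complex"
  assumes "pseudo_reflection_group G"
    and "admissible G mu tau"
  shows "satisfies_BG_relations G mu tau iota (pmap G mu tau)"
proof -
  interpret reflection_group_parameters G mu tau
    using assms by unfold_locales
  show ?thesis
    unfolding satisfies_BG_relations_def
    by (intro conjI ballI impI allI)
      (simp_all add: iota_mat1 iota_mult iota_pmap_absorb sgen_fixes_hyperplane pmap_square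
        iota_pmap_intertwine pmap_commute_transversal pmap_mult_Rij pmap_mult_Rij_empty)
qed

end
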